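(* Let $P(x)$ be an antireciprocal, primitive polynomial of degree $d>7$ with integer coefficients having exactly six nonzero coefficients, each equal to $1$ or $-1$. Then there is a natural number $p<d$ such that $P(x)(x^p-1)$ is a reciprocal polynomial with exactly eight nonzero coefficients, each equal to $1$ or $-1$, and the house of $P(x)(x^p-1)$ equals the house of $P(x)$.
   Context: A polynomial $P(x)$ of degree $d$ is reciprocal if $x^dP(1/x)=P(x)$ and antireciprocal if $P(x) = -x^dP(1/x)$. A polynomial $P(x)$ is primitive if it cannot be written as $Q(x^k)$ for a polynomial $Q$ and an integer $k\ge 2$. The house of a polynomial is the maximum modulus of its complex roots. *)

theory Defs
  imports Complex_Main "HOL-Computational_Algebra.Polynomial"
begin

(* reflect_poly P is x^d * P(1/x) for d = degree P, also when the constant coefficient vanishes. *)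

definition reciprocal :: "'a::comm_ring_1 poly \<Rightarrow> bool" where
  "reciprocal P \<longleftrightarrow> reflect_poly P = P"

definition antireciprocal :: "'a::comm_ring_1 poly \<Rightarrow> bool" where
  "antireciprocal P \<longleftrightarrow> P = - reflect_poly P"

(* Not a condition on the content: P is primitive if it is not of the form Q(x^k) with k >= 2. *)
definition primitive_poly :: "'a::comm_ring_1 poly \<Rightarrow> bool" where
  "primitive_poly P \<longleftrightarrow> \<not> (\<exists>Q k. k \<ge> 2 \<and> P = pcompose Q (monom 1 k))"

(* Meaningful for nonconstant P only, where the set of complex roots is finite and nonempty. *)
definition house :: "int poly \<Rightarrow> real" where
  "house P = Max {cmod z | z. poly (map_poly of_int P) z = 0}"

definition unit_coeffs :: "nat \<Rightarrow> int poly \<Rightarrow> bool" where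
  "unit_coeffs n P \<longleftrightarrow>
     card {i. coeff P i \<noteq> 0} = n \<and> (\<forall>i. coeff P i \<noteq> 0 \<longrightarrow> coeff P i = 1 \<or> coeff P i = -1)"

end

theory Submission
  imports Defs
begin

text \<open>
  Let \<open>A\<close> and \<open>N\<close> be the sets of exponents of coefficient \<open>1\<close> and \<open>-1\<close>; antireciprocity says
  that \<open>i \<mapsto> d - i\<close> exchanges them, so both have three elements. The product with \<open>x^p - 1\<close> has
  eight unit coefficients if \<open>p\<close> is the difference of exactly one pair in \<open>A\<close> (hence of exactly
  one in \<open>N\<close>) and is not a difference between \<open>A\<close> and \<open>N\<close>. Up to the sign of \<open>P\<close> we have
  \<open>A = {u, v, d}\<close>, and one of \<open>v - u\<close>, \<open>d - u\<close>, \<open>d - v\<close> is such a \<open>p\<close> unless \<open>(u, v, d)\<close> is a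
  multiple of \<open>(2, 4, 5)\<close>, \<open>(3, 4, 5)\<close>, \<open>(4, 5, 6)\<close> or \<open>(4, 5, 7)\<close>, which primitivity and
  \<open>d > 7\<close> exclude. The house does not change since \<open>P\<close> vanishes at \<open>1\<close> and so has a root of
  modulus at least \<open>1\<close>.
\<close>

section \<open>Multiplication by \<open>x^p - 1\<close>, primitivity and the house\<close>

lemma coeff_mult_monom_minus_one:
  fixes P :: "'a::comm_ring_1 poly"
  shows "coeff (P * (monom 1 p - 1)) i = (if p \<le> i then coeff P (i - p) else 0) - coeff P i"
  by (simp add: right_diff_distrib coeff_monom_mult mult.commute[of P])

text \<open>Reflection is multiplicative, so this sign cancels against the one from the
  antireciprocal \<open>P\<close> and the product is reciprocal.\<close>

lemma reflect_poly_monom_minus_one: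
  assumes "p > 0"
  shows "reflect_poly (monom 1 p - 1 :: int poly) = - (monom 1 p - 1)"
proof -
  have "degree (monom 1 p - 1 :: int poly) = p"
    using assms degree_add_eq_left[of "-1" "monom 1 p :: int poly"] by (simp add: degree_monom_eq)
  then show ?thesis
    using assms by (intro poly_eqI) (auto simp: coeff_reflect_poly)
qed

lemma pcompose_monom_monom:
  fixes c :: "'a::comm_ring_1"
  shows "pcompose (monom c n) (monom 1 k) = monom c (k * n)"
  by (induction n)
    (simp_all add: monom_0 monom_Suc pcompose_pCons mult_monom flip: monom_0[of 0])

lemma dvd_exponents_imp_not_primitive:
  fixes P :: "'a::comm_ring_1 poly"
  assumes "k \<ge> 2" and "\<And>i. coeff P i \<noteq> 0 \<Longrightarrow> k dvd i"
  shows "\<not> primitive_poly P"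
proof -
  define Q where "Q = (\<Sum>i\<le>degree P. monom (coeff P i) (i div k))"
  have "pcompose Q (monom 1 k) = (\<Sum>i\<le>degree P. monom (coeff P i) (k * (i div k)))"
    unfolding Q_def pcompose_sum
    by (intro sum.cong refl) (rule pcompose_monom_monom)
  also have "\<dots> = (\<Sum>i\<le>degree P. monom (coeff P i) i)"
  proof (intro sum.cong refl)
    fix i show "monom (coeff P i) (k * (i div k)) = monom (coeff P i) i"
      \<comment> \<open>If \<open>k\<close> does not divide \<open>i\<close>, the exponents differ
        but both monomials are zero.\<close>
      using assms(2)[of i] by (cases "coeff P i = 0") auto
  qed
  also have "\<dots> = P"
    by (rule poly_as_sum_of_monoms)
  finally show ?thesis
    using assms(1) unfolding primitive_poly_def by metis
qed

text \<open>The new roots lie on the unit circle, and \<open>P\<close> already has the root 1, so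
  even the set of moduli is unchanged.\<close>

lemma house_mult_monom_minus_one:
  assumes "P \<noteq> 0" and "poly P 1 = 0" and "p > 0"
  shows "house (P * (monom 1 p - 1)) = house P"
proof -
  let ?c = "map_poly of_int :: int poly \<Rightarrow> complex poly"
  let ?R = "{cmod z | z. poly (?c P) z = 0}"
  have "?c P \<noteq> 0"
    using assms(1) by (subst map_poly_eq_0_iff) auto
  then have fin: "finite ?R"
    using poly_roots_finite[of "?c P"] by (simp add: setcompr_eq_image)
  have "poly (?c P) 1 = of_int (poly P 1)"
    by (simp add: poly_altdef coeff_map_poly degree_map_poly)
  then have one: "1 \<in> ?R"
    using assms(2) by (intro CollectI exI[of _ "1::complex"]) simp
  have "?c (P * (monom 1 p - 1)) = ?c P * (monom 1 p - 1)"
    by (intro poly_eqI) (simp add: coeff_map_poly coeff_mult_monom_minus_one)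
  then have mon: "poly (?c (P * (monom 1 p - 1))) z = poly (?c P) z * (z ^ p - 1)" for z
    by (simp add: poly_monom)
  have "cmod z = 1" if "z ^ p = 1" for z
    using that assms(3) power_eq_1_iff by blast
  then have "{cmod z | z. poly (?c (P * (monom 1 p - 1))) z = 0} = ?R"
    unfolding mon using one by auto
  then show ?thesis
    unfolding house_def by simp
qed

section \<open>Differences of the exponents\<close>

text \<open>The forbidden values \<open>u\<close>, \<open>v\<close> and the three absolute values
  are, besides \<open>d\<close>, the differences between \<open>{u, v, d}\<close> and its mirror
  image \<open>{d - u, d - v, 0}\<close>. The implication rules out that \<open>p\<close> occurs
  twice as a difference inside \<open>{u, v, d}\<close>.\<close>

lemma good_shift_exists_int:
  fixes u v d :: int
  assumes "0 < u" "u < v" "v < d" "d > 7"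
    and "2 * u \<noteq> d" "2 * v \<noteq> d" "u + v \<noteq> d"
    and prim: "\<And>k. k \<ge> 2 \<Longrightarrow> \<not> (k dvd u \<and> k dvd v \<and> k dvd d)"
  shows "\<exists>p \<in> {v - u, d - u, d - v}. (p = v - u \<longrightarrow> p \<noteq> d - v)
    \<and> p \<noteq> u \<and> p \<noteq> v \<and> p \<noteq> \<bar>2 * u - d\<bar> \<and> p \<noteq> \<bar>2 * v - d\<bar> \<and> p \<noteq> \<bar>u + v - d\<bar>"
proof (rule ccontr)
  assume "\<not> ?thesis"
  then have bad: "v - u = d - v \<or> v - u = u \<or> v - u = v \<or> v - u = \<bar>2 * u - d\<bar>
        \<or> v - u = \<bar>2 * v - d\<bar> \<or> v - u = \<bar>u + v - d\<bar>"
      "d - u = v - u \<or> d - u = u \<or> d - u = v \<or> d - u = \<bar>2 * u - d\<bar> \<or> d - u = \<bar>2 * v - d\<bar>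
        \<or> d - u = \<bar>u + v - d\<bar>"
      "d - v = v - u \<or> d - v = u \<or> d - v = v \<or> d - v = \<bar>2 * u - d\<bar> \<or> d - v = \<bar>2 * v - d\<bar>
        \<or> d - v = \<bar>u + v - d\<bar>"
    by blast+
  \<comment> \<open>For each candidate the absolute values are opened and the equations
    contradicting the hypotheses are dropped.\<close>
  have "v - u = d - v \<or> v = 2 * u \<or> v - u = d - 2 * u \<or> v - u = 2 * u - d \<or> v - u = 2 * v - d
      \<or> v - u = d - 2 * v \<or> v - u = u + v - d \<or> v - u = d - u - v"
    using bad(1) \<open>0 < u\<close> by (smt (verit))
  moreover have "d - v = v - u \<or> d - v = d - 2 * u \<or> d - v = 2 * u - d \<or> d - v = 2 * v - d
      \<or> d - v = u + v - d"
    using bad(3)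
    by (elim disjE) (use assms(1-3,5-7) in \<open>simp_all add: abs_if split: if_splits\<close>)
  moreover have "d - u = 2 * u - d \<or> d - u = 2 * v - d \<or> d - u = u + v - d"
    using bad(2)
    by (elim disjE) (use assms(1-3,5-7) in \<open>simp_all add: abs_if split: if_splits\<close>)
  \<comment> \<open>The 7 * 5 * 3 combinations are homogeneous linear systems in \<open>u\<close>,
    \<open>v\<close>, \<open>d\<close>; under the order and the inequations only four rays
    survive.\<close>
  ultimately have "5 * u = 2 * d \<and> 5 * v = 4 * d \<or> 5 * u = 3 * d \<and> 5 * v = 4 * d
      \<or> 6 * u = 4 * d \<and> 6 * v = 5 * d \<or> 7 * u = 4 * d \<and> 7 * v = 5 * d"
    using assms(1-3,5-7) by (smt (verit))
  then obtain x where x: "(u = 2 * x \<and> v = 4 * x \<and> d = 5 * x) \<or> (u = 3 * x \<and> v = 4 * x \<and> d = 5 * x)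
      \<or> (u = 4 * x \<and> v = 5 * x \<and> d = 6 * x) \<or> (u = 4 * x \<and> v = 5 * x \<and> d = 7 * x)"
    \<comment> \<open>The scale \<open>x\<close> is an integer because it is a difference of two
      exponents: \<open>v - u\<close> on the ray of (4, 5, 7), \<open>d - v\<close> on the
      others.\<close>
    by (elim disjE) (rule that[of "d - v"], simp; fail | rule that[of "v - u"], simp)+
  \<comment> \<open>On every ray \<open>d \<le> 7 * x\<close>. Then \<open>x\<close> is a common
    divisor that \<open>prim\<close> forbids.\<close>
  then have "x \<ge> 2"
    using \<open>d > 7\<close> by auto
  with prim[of x] x show False
    by auto
qed

lemma good_shift_exists:
  fixes u v d :: nat
  assumes "0 < u" "u < v" "v < d" "d > 7"
    and "2 * u \<noteq> d" "2 * v \<noteq> d" "u + v \<noteq> d"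
    and prim: "\<And>k. k \<ge> 2 \<Longrightarrow> \<not> (k dvd u \<and> k dvd v \<and> k dvd d)"
  defines "A \<equiv> {u, v, d}" and "N \<equiv> {d - u, d - v, 0}"
  shows "\<exists>p. 0 < p \<and> p < d \<and> card (A \<inter> (\<lambda>i. i + p) ` A) = 1 \<and> card (N \<inter> (\<lambda>i. i + p) ` N) = 1
    \<and> A \<inter> (\<lambda>i. i + p) ` N = {} \<and> N \<inter> (\<lambda>i. i + p) ` A = {}"
proof -
  have "\<not> (k dvd int u \<and> k dvd int v \<and> k dvd int d)" if "k \<ge> 2" for k
    using prim[of "nat k"] that by (simp add: nat_dvd_iff)
  then have "\<exists>q \<in> {int v - int u, int d - int u, int d - int v}. (q = int v - int u \<longrightarrow> q \<noteq> int d - int v)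
      \<and> q \<noteq> int u \<and> q \<noteq> int v \<and> q \<noteq> \<bar>2 * int u - int d\<bar> \<and> q \<noteq> \<bar>2 * int v - int d\<bar>
      \<and> q \<noteq> \<bar>int u + int v - int d\<bar>"
    using assms(1-7) by (intro good_shift_exists_int) auto
  then obtain q where q: "q \<in> {int v - int u, int d - int u, int d - int v}"
      "q = int v - int u \<longrightarrow> q \<noteq> int d - int v" "q \<noteq> int u" "q \<noteq> int v"
      "q \<noteq> \<bar>2 * int u - int d\<bar>" "q \<noteq> \<bar>2 * int v - int d\<bar>" "q \<noteq> \<bar>int u + int v - int d\<bar>"
    by blast
  define p where "p = nat q"
  have "q > 0" "q < int d"
    using q(1) assms(1-3) by auto
  then have p: "0 < p" "p < d" "int p = q"
    by (auto simp: p_def)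
  have "card (A \<inter> (\<lambda>i. i + p) ` A) = 1 \<and> card (N \<inter> (\<lambda>i. i + p) ` N) = 1"
  proof -
    have "v = u + p \<or> d = u + p \<or> d = v + p"
      using q(1) p(3) by auto
    moreover have "v \<noteq> u + p \<or> v + p \<noteq> d"
      using q(2) p(3) by auto
    \<comment> \<open>Since \<open>d - u\<close> exceeds the other two differences, only
      \<open>v - u = d - v\<close> could make \<open>p\<close> occur twice.\<close>
    ultimately consider "v = u + p" "v + p \<noteq> d" | "d = u + p" | "d = v + p" "v \<noteq> u + p"
      by blast
    then show ?thesis
    proof cases
      case 1
      then have "A \<inter> (\<lambda>i. i + p) ` A = {v}" "N \<inter> (\<lambda>i. i + p) ` N = {d - u}"
        using p(1) assms(1-3) unfolding A_def N_def by auto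
      then show ?thesis by simp
    next
      case 2
      then have "A \<inter> (\<lambda>i. i + p) ` A = {d}" "N \<inter> (\<lambda>i. i + p) ` N = {d - u}"
        using p(1) assms(1-3) unfolding A_def N_def by auto
      then show ?thesis by simp
    next
      case 3
      then have "A \<inter> (\<lambda>i. i + p) ` A = {d}" "N \<inter> (\<lambda>i. i + p) ` N = {d - v}"
        using p(1) assms(1-3) unfolding A_def N_def by auto
      then show ?thesis by simp
    qed
  qed
  moreover have "A \<inter> (\<lambda>i. i + p) ` N = {}" "N \<inter> (\<lambda>i. i + p) ` A = {}"
  proof -
    have "u + p \<noteq> d - u" "d - u + p \<noteq> u"
      using q(5) p(3) assms(2,3) by linarith+
    moreover have "v + p \<noteq> d - v" "d - v + p \<noteq> v"
      using q(6) p(3) assms(2,3) by linarith+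
    moreover have "u + p \<noteq> d - v" "d - v + p \<noteq> u" "v + p \<noteq> d - u" "d - u + p \<noteq> v"
      using q(7) p(3) assms(2,3) by linarith+
    moreover have "0 + p \<noteq> u" "0 + p \<noteq> v" "0 + p \<noteq> d" "d - u + p \<noteq> d" "d - v + p \<noteq> d"
      using q(3,4) p(2,3) assms(2,3) by linarith+
    moreover have "d + p \<noteq> d - u" "d + p \<noteq> d - v" "u + p \<noteq> 0" "v + p \<noteq> 0" "d + p \<noteq> 0"
      using p(1) by linarith+
    ultimately show "A \<inter> (\<lambda>i. i + p) ` N = {}" "N \<inter> (\<lambda>i. i + p) ` A = {}"
      unfolding A_def N_def
      by (simp_all only: image_insert image_empty disjoint_insert Int_empty_right insert_iff empty_iff simp_thms)
  qed
  ultimately show ?thesis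
    using p by (intro exI[of _ p]) simp
qed

section \<open>Counting the coefficients of the product\<close>

text \<open>Each of \<open>A\<close> and \<open>N\<close> overlaps its shift in one place, where the
  coefficients cancel. This leaves two exponents in each of the four sets, eight in all.\<close>

lemma unit_coeffs_mult_monom_minus_one:
  fixes P :: "int poly"
  defines "A \<equiv> {i. coeff P i = 1}" and "N \<equiv> {i. coeff P i = -1}"
  assumes units: "\<And>i. coeff P i \<noteq> 0 \<Longrightarrow> coeff P i = 1 \<or> coeff P i = -1"
    and card: "card A = 3" "card N = 3"
    and AA: "card (A \<inter> (\<lambda>i. i + p) ` A) = 1" and NN: "card (N \<inter> (\<lambda>i. i + p) ` N) = 1"
    and AN: "A \<inter> (\<lambda>i. i + p) ` N = {}" and NA: "N \<inter> (\<lambda>i. i + p) ` A = {}"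
  shows "unit_coeffs 8 (P * (monom 1 p - 1))"
proof -
  let ?A' = "(\<lambda>i. i + p) ` A" and ?N' = "(\<lambda>i. i + p) ` N"
  let ?Q = "P * (monom 1 p - 1)"
  have fin: "finite A" "finite N"
    using card by (auto intro: card_ge_0_finite)
  have card': "card ?A' = 3" "card ?N' = 3"
    using card by (auto simp: card_image)
  have mem': "i \<in> ?A' \<longleftrightarrow> p \<le> i \<and> coeff P (i - p) = 1"
      "i \<in> ?N' \<longleftrightarrow> p \<le> i \<and> coeff P (i - p) = -1" for i
    by (auto simp: A_def N_def image_iff intro!: exI[of _ "i - p"])
  have units': "coeff P i = 0 \<or> coeff P i = 1 \<or> coeff P i = -1" for i
    using units by blast
  have pos: "coeff ?Q i = 1 \<longleftrightarrow> i \<in> (?A' - A) \<union> (N - ?N')"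
    and neg: "coeff ?Q i = -1 \<longleftrightarrow> i \<in> (A - ?A') \<union> (?N' - N)"
    and cs: "coeff ?Q i = 0 \<or> coeff ?Q i = 1 \<or> coeff ?Q i = -1" for i
  proof -
    \<comment> \<open>These are the places where the coefficient would be -2 and 2,
      respectively.\<close>
    have "i \<notin> A \<inter> ?N'" "i \<notin> N \<inter> ?A'" using AN NA by auto
    then show "coeff ?Q i = 1 \<longleftrightarrow> i \<in> (?A' - A) \<union> (N - ?N')"
      "coeff ?Q i = -1 \<longleftrightarrow> i \<in> (A - ?A') \<union> (?N' - N)"
      "coeff ?Q i = 0 \<or> coeff ?Q i = 1 \<or> coeff ?Q i = -1"
      unfolding coeff_mult_monom_minus_one Int_iff Un_iff Diff_iff mem'
      using units'[of i] units'[of "i - p"] by (auto simp: A_def N_def)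
  qed
  have supp: "{i. coeff ?Q i \<noteq> 0} = ((?A' - A) \<union> (A - ?A')) \<union> ((?N' - N) \<union> (N - ?N'))"
  proof (intro set_eqI)
    fix i
    have "coeff ?Q i \<noteq> 0 \<longleftrightarrow> coeff ?Q i = 1 \<or> coeff ?Q i = -1"
      using cs[of i] by auto
    then show "i \<in> {i. coeff ?Q i \<noteq> 0} \<longleftrightarrow> i \<in> ((?A' - A) \<union> (A - ?A')) \<union> ((?N' - N) \<union> (N - ?N'))"
      unfolding pos neg by blast
  qed
  have "A \<inter> N = {}" "?A' \<inter> ?N' = {}"
    by (auto simp: A_def N_def)
  then have disj: "(?A' - A) \<inter> (A - ?A') = {}" "(?N' - N) \<inter> (N - ?N') = {}"
      "((?A' - A) \<union> (A - ?A')) \<inter> ((?N' - N) \<union> (N - ?N')) = {}"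
    using AN NA by blast+
  have "card {i. coeff ?Q i \<noteq> 0} =
      (card (?A' - A) + card (A - ?A')) + (card (?N' - N) + card (N - ?N'))"
    unfolding supp using fin disj by (simp only: card_Un_disjoint finite_Un finite_Diff finite_imageI simp_thms)
  also have "\<dots> = 8"
  proof -
    have diff: "card (X - Y) = 2" if "card X = 3" "card (X \<inter> Y) = 1" "finite X" for X Y :: "nat set"
      using that by (simp add: card_Diff_subset_Int)
    show ?thesis
      using fin card card' AA NN diff[of A ?A'] diff[of ?A' A] diff[of N ?N'] diff[of ?N' N]
      by (simp add: Int_commute)
  qed
  finally show ?thesis
    using cs unfolding unit_coeffs_def by blast
qed

section \<open>The exponent sets of an antireciprocal polynomial\<close>

theorem theorem3:
  fixes P :: "int poly" and d :: nat
  assumes "degree P = d" and "d > 7"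
    and "antireciprocal P" and "primitive_poly P"
    and "unit_coeffs 6 P"
  shows "\<exists>p::nat. 0 < p \<and> p < d \<and>
           reciprocal (P * (monom 1 p - 1)) \<and>
           unit_coeffs 8 (P * (monom 1 p - 1)) \<and>
           house (P * (monom 1 p - 1)) = house P"
proof -
  define A where "A = {i. coeff P i = 1}"
  define N where "N = {i. coeff P i = -1}"
  have reflect: "reflect_poly P = - P"
    using assms(3) unfolding antireciprocal_def by (metis minus_minus)
  have anti: "coeff P (d - i) = - coeff P i" if "i \<le> d" for i
    using arg_cong[OF reflect, of "\<lambda>q. coeff q i"] that assms(1) by (simp add: coeff_reflect_poly)
  have units: "coeff P i = 1 \<or> coeff P i = -1" if "coeff P i \<noteq> 0" for i
    using assms(5) that unfolding unit_coeffs_def by blast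
  have le: "i \<le> d" if "coeff P i \<noteq> 0" for i
    using assms(1) le_degree that by blast
  have "P \<noteq> 0"
    using assms(1,2) by auto
  then have lead: "d \<in> A \<or> d \<in> N"
    using units[of d] assms(1) by (auto simp: A_def N_def)
  have subd: "A \<subseteq> {..d}" "N \<subseteq> {..d}"
    using le by (auto simp: A_def N_def)
  have mirror: "d - i \<in> N \<longleftrightarrow> i \<in> A" "d - i \<in> A \<longleftrightarrow> i \<in> N" if "i \<le> d" for i
    using anti[OF that] by (auto simp: A_def N_def)
  \<comment> \<open>The bounds by \<open>d\<close> make the truncated subtraction
    \<open>d - i\<close> an involution on the sets.\<close>
  have image_mirror: "M = (\<lambda>i. d - i) ` B"
    if "\<And>i. i \<le> d \<Longrightarrow> d - i \<in> M \<longleftrightarrow> i \<in> B" "B \<subseteq> {..d}" "M \<subseteq> {..d}" for B M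
  proof (intro set_eqI iffI)
    fix i assume "i \<in> M"
    then show "i \<in> (\<lambda>i. d - i) ` B"
      using that(1)[of "d - i"] that(3) by (intro image_eqI[of _ _ "d - i"]) auto
  next
    fix i assume "i \<in> (\<lambda>i. d - i) ` B"
    then show "i \<in> M"
      using that(1,2) by auto
  qed
  have NA: "N = (\<lambda>i. d - i) ` A"
    by (rule image_mirror) (use mirror subd in auto)
  have AN: "A = (\<lambda>i. d - i) ` N"
    by (rule image_mirror) (use mirror subd in auto)
  have fin: "finite A" "finite N"
    using subd finite_subset[OF _ finite_atMost] by blast+
  have "card N = card A"
    unfolding NA using subd(1) by (intro card_image inj_onI) (metis atMost_iff diff_diff_cancel subsetD)
  moreover have "{i. coeff P i \<noteq> 0} = A \<union> N" and "A \<inter> N = {}"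
    using units by (auto simp: A_def N_def)
  ultimately have card: "card A = 3" "card N = 3"
    using assms(5) fin card_Un_disjoint[of A N] unfolding unit_coeffs_def by auto
  \<comment> \<open>Here \<open>B\<close> is whichever of \<open>A\<close> and \<open>N\<close>
    contains the leading exponent, which covers both signs of \<open>P\<close>.\<close>
  have key: "\<exists>p. 0 < p \<and> p < d \<and> card (B \<inter> (\<lambda>i. i + p) ` B) = 1 \<and> card (M \<inter> (\<lambda>i. i + p) ` M) = 1
      \<and> B \<inter> (\<lambda>i. i + p) ` M = {} \<and> M \<inter> (\<lambda>i. i + p) ` B = {}"
    if B: "d \<in> B" "card B = 3" "M = (\<lambda>i. d - i) ` B" "B \<inter> M = {}" "B \<subseteq> {..d}" "B \<union> M = A \<union> N" for B M
  proof -
    have "card (B - {d}) = 2"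
      using B(1,2) by simp
    then obtain u v where uv: "B - {d} = {u, v}" "u < v"
      by (metis card_2_iff insert_commute linorder_neqE_nat)
    then have Beq: "B = {u, v, d}"
      using B(1) by auto
    have Meq: "M = {d - u, d - v, 0}"
      using B(3) Beq by auto
    have neq: "u < d" "v < d"
      using B(5) uv(1) by (metis DiffE atMost_iff insertCI le_neq_implies_less singletonI subsetD)+
    \<comment> \<open>An exponent cannot carry both signs, so no element of \<open>B\<close> is the
      mirror image of another or of itself.\<close>
    have "d - u \<notin> {u, v}" "d - v \<noteq> v" "0 \<noteq> u"
      using B(4) unfolding Beq Meq by blast+
    then have "0 < u" "2 * u \<noteq> d" "2 * v \<noteq> d" "u + v \<noteq> d"
      using neq by auto
    \<comment> \<open>A common divisor of \<open>u\<close>, \<open>v\<close>, \<open>d\<close> also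
      divides the mirrored exponents, so \<open>P\<close> would be a polynomial in
      \<open>x^k\<close>.\<close>
    moreover have "\<not> (k dvd u \<and> k dvd v \<and> k dvd d)" if "k \<ge> 2" for k
    proof
      assume "k dvd u \<and> k dvd v \<and> k dvd d"
      then have "\<forall>i \<in> B \<union> M. k dvd i"
        unfolding Beq Meq by simp
      then have "k dvd i" if "coeff P i \<noteq> 0" for i
        using units[OF that] unfolding B(6) by (auto simp: A_def N_def)
      then show False
        using dvd_exponents_imp_not_primitive[OF \<open>k \<ge> 2\<close>] assms(4) by blast
    qed
    ultimately show ?thesis
      unfolding Beq Meq using good_shift_exists[of u v d] uv(2) neq assms(2) by blast
  qed
  obtain p where p: "0 < p" "p < d" "card (A \<inter> (\<lambda>i. i + p) ` A) = 1"
      "card (N \<inter> (\<lambda>i. i + p) ` N) = 1" "A \<inter> (\<lambda>i. i + p) ` N = {}" "N \<inter> (\<lambda>i. i + p) ` A = {}"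
    using lead
  proof
    assume "d \<in> A"
    then show ?thesis
      using key[OF _ card(1) NA \<open>A \<inter> N = {}\<close> subd(1) refl] that by blast
  next
    assume "d \<in> N"
    then show ?thesis
      using key[OF _ card(2) AN _ subd(2) Un_commute] \<open>A \<inter> N = {}\<close> that by blast
  qed
  have "reciprocal (P * (monom 1 p - 1))"
    unfolding reciprocal_def reflect_poly_mult reflect reflect_poly_monom_minus_one[OF p(1)]
    by (simp add: algebra_simps)
  moreover have "unit_coeffs 8 (P * (monom 1 p - 1))"
    by (rule unit_coeffs_mult_monom_minus_one[OF units card[unfolded A_def N_def] p(3-6)[unfolded A_def N_def]])
  moreover have "poly P 1 = 0"
  proof -
    have val: "poly P 1 = (\<Sum>i=0..d. coeff P i)"
      using assms(1) by (simp add: poly_altdef atMost_atLeast0)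
    also have "\<dots> = (\<Sum>i=0..d. coeff P (d - i))"
      by (subst sum.atLeastAtMost_rev) simp
    also have "\<dots> = (\<Sum>i=0..d. - coeff P i)"
      by (intro sum.cong) (auto simp: anti)
    also have "\<dots> = - poly P 1"
      unfolding val by (rule sum_negf)
    finally show ?thesis
      by simp
  qed
  ultimately show ?thesis
    using p house_mult_monom_minus_one[OF \<open>P \<noteq> 0\<close>, of p] by blast
qed

end
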